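(* Let $R$ be the ring of integers of a complete absolutely unramified discrete valuation field of characteristic zero and residue characteristic $p>0$, equipped with a ring endomorphism $\sigma:R\to R$ lifting the $p$th power Frobenius on the residue field $R/pR$. Let $F(x,y)\in R[[x,y]]$ be a one-dimensional formal group law of height $h$. When $h<\infty$, denote by $\Psi_F(T)=p-\sum_{i=1}^h\alpha_iT^i\in R[T]$ the characteristic polynomial of $F$. Write the logarithm of $F$ as $\log_F(x)=\sum_{n=1}^\infty\frac{b_{n-1}}{n}x^n$, where $\{b_n;\,n\ge0\}$ is a sequence of elements of $R$ with $b_0=1$. (i) If $h=\infty$ then $\mathrm{ord}_p(b_{p^n-1})\ge n$ for all $n \geq 0$. If $h<\infty$ then $\mathrm{ord}_p(b_{p^n-1})\ge n-\lfloor \frac nh\rfloor$ for all $n \geq 0$, with equality when $h\mid n$. (ii) When $h<\infty$, consider the elements $\beta_n=b_{p^n-1}/p^{\,n-\lfloor n/h\rfloor}\in R$. Then for every $k \geq 1$ $$\beta_{kh}\equiv\prod_{i=0}^{k-1}\sigma^{ih}(\beta_h)\mod p.$$ (iii) When $h<\infty$, for every $k\ge1$ consider the $h\times h$ matrix with coefficients in $R$ $$D_k=\Bigl(p^{\varepsilon_{ij}}\,\sigma^{j+1}(\beta_{kh-1+i-j})\Bigr)_{0\le i,j\le h-1},\qquad \varepsilon_{ij}=\begin{cases}0,& j<i\text{ or }j=h-1,\\ 1,& i\le j<h-1.\end{cases}$$ Then $\det D_k\equiv(-1)^{h-1}\prod_{s=1}^{kh-1}\sigma^s(\beta_h)\not\equiv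 0 \mod p$, and $$\begin{pmatrix}\alpha_1/p\\ \alpha_2/p\\ \vdots\\ \alpha_{h-1}/p\\ \alpha_h\end{pmatrix}\equiv D_k^{-1}\begin{pmatrix}\beta_{kh}\\ \beta_{kh+1}\\ \vdots\\ \beta_{kh+h-2}\\ \beta_{kh+h-1}\end{pmatrix}\mod p^k.$$
   Context: The logarithm of a one-dimensional formal group law $F$ over a characteristic zero ring $R$ is the unique series $f(x)=\log_F(x)\in x+x^2(R\otimes\mathbb{Q})[[x]]$ with $F(x,y)=f^{-1}(f(x)+f(y))$; it has the form $\sum_{n\ge1}\frac{b_{n-1}}{n}x^n$ with $b_n\in R$, $b_0=1$. An isomorphism of formal group laws is strict if it is $\equiv x$ modulo degree $\ge2$. $\mathrm{ord}_p$ is the normalized valuation ($\mathrm{ord}_p(p)=1$). Extend $\sigma$ to $R\otimes\mathbb{Q}$ by $\mathbb{Q}$-linearity and to power series by $\sigma(x)=x^p$, so $(\sigma^s f)(x)$ is obtained from $f$ by applying $\sigma^s$ to the coefficients and replacing $x$ by $x^{p^s}$. Height and characteristic polynomial: for every formal group law $F$ over $R$ with logarithm $f$ there is a sequence $v_1,v_2,\ldots\in R$ with $f(x)-\frac1p\sum_{s\ge1}v_s\,(\sigma^sf)(x)\in R[[x]]$. The height is $h=\inf\{s\ge1: v_s\in R^\times\}$ (with $h=\infty$ if no $v_s$ is a unit); it does not depend on the choice of $\{v_s\}$. If $h=\infty$ then $f(x)\in R[[x]]$. If $h<\infty$ there exist unique $\alpha_1,\dots,\alpha_{h-1}\in pR$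 and $\alpha_h\in R^\times$ such that $f(x)-\frac1p\sum_{s=1}^h\alpha_s\,(\sigma^sf)(x)\in R[[x]]$, and the characteristic polynomial of $F$ is $\Psi_F(T)=p-\sum_{i=1}^h\alpha_iT^i$. *)

theory Defs
  imports
    "HOL-Library.Extended"
    "HOL-Library.Extended_Nat"
    "HOL-Computational_Algebra.Formal_Power_Series"
    "HOL-Computational_Algebra.Polynomial"
    "HOL-Computational_Algebra.Primes"
    "Jordan_Normal_Form.Determinant"
begin

text \<open>
  The symbol for infinity is reserved for \<^typ>\<open>enat\<close> (heights); the value of the valuation at
  zero is written \<^const>\<open>Pinf\<close>.
\<close>

no_notation Pinf (\<open>\<infinity>\<close>)
no_notation Minf (\<open>-\<infinity>\<close>)


section \<open>The base ring\<close>

text \<open>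
  The field is the whole type \<open>'k\<close>, with its discrete valuation \<open>\<nu>\<close>. That \<open>\<nu> p = 1\<close> says at the
  same time that the residue characteristic is \<open>p\<close>, that the field is absolutely unramified and
  that \<open>\<nu>\<close> is the normalized valuation.
\<close>

definition unramified_cdvf :: "nat \<Rightarrow> ('k::field_char_0 \<Rightarrow> int extended) \<Rightarrow> bool" where
  "unramified_cdvf p \<nu> \<longleftrightarrow>
     prime p \<and>
     (\<forall>x. \<nu> x \<noteq> Minf) \<and>
     (\<forall>x. \<nu> x = Pinf \<longleftrightarrow> x = 0) \<and>
     (\<forall>x y. \<nu> (x * y) = \<nu> x + \<nu> y) \<and>
     (\<forall>x y. min (\<nu> x) (\<nu> y) \<le> \<nu> (x + y)) \<and>
     \<nu> (of_nat p) = Fin 1 \<and>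
     (\<forall>X :: nat \<Rightarrow> 'k.
        (\<forall>N::int. \<exists>M. \<forall>m\<ge>M. \<forall>n\<ge>M. Fin N \<le> \<nu> (X m - X n)) \<longrightarrow>
        (\<exists>L. \<forall>N::int. \<exists>M. \<forall>n\<ge>M. Fin N \<le> \<nu> (X n - L)))"

definition int_ring :: "('k::field_char_0 \<Rightarrow> int extended) \<Rightarrow> 'k set" where
  "int_ring \<nu> = {x. 0 \<le> \<nu> x}"

definition int_units :: "('k::field_char_0 \<Rightarrow> int extended) \<Rightarrow> 'k set" where
  "int_units \<nu> = {x \<in> int_ring \<nu>. \<exists>y\<in>int_ring \<nu>. x * y = 1}"

definition cong_ppow ::
  "nat \<Rightarrow> ('k::field_char_0 \<Rightarrow> int extended) \<Rightarrow> nat \<Rightarrow> 'k \<Rightarrow> 'k \<Rightarrow> bool" where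
  "cong_ppow p \<nu> k x y \<longleftrightarrow> (\<exists>r\<in>int_ring \<nu>. x - y = of_nat p ^ k * r)"

text \<open>Only the values of \<open>\<sigma>\<close> on the ring of integers matter.\<close>

definition frobenius_lift ::
  "nat \<Rightarrow> ('k::field_char_0 \<Rightarrow> int extended) \<Rightarrow> ('k \<Rightarrow> 'k) \<Rightarrow> bool" where
  "frobenius_lift p \<nu> \<sigma> \<longleftrightarrow>
     (\<forall>x\<in>int_ring \<nu>. \<sigma> x \<in> int_ring \<nu>) \<and>
     \<sigma> 1 = 1 \<and>
     (\<forall>x\<in>int_ring \<nu>. \<forall>y\<in>int_ring \<nu>. \<sigma> (x + y) = \<sigma> x + \<sigma> y) \<and>
     (\<forall>x\<in>int_ring \<nu>. \<forall>y\<in>int_ring \<nu>. \<sigma> (x * y) = \<sigma> x * \<sigma> y) \<and>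
     (\<forall>x\<in>int_ring \<nu>. cong_ppow p \<nu> 1 (\<sigma> x) (x ^ p))"

text \<open>
  The tensor product of the ring of integers with the rationals is the field itself, since every
  element becomes integral after multiplication by a power of \<open>p\<close>. This gives the extension of
  \<open>\<sigma>\<close> by linearity over the rationals.
\<close>

definition frob_ext ::
  "nat \<Rightarrow> ('k::field_char_0 \<Rightarrow> int extended) \<Rightarrow> ('k \<Rightarrow> 'k) \<Rightarrow> 'k \<Rightarrow> 'k" where
  "frob_ext p \<nu> \<sigma> x =
     (let n = (LEAST n. of_nat p ^ n * x \<in> int_ring \<nu>)
      in \<sigma> (of_nat p ^ n * x) / of_nat p ^ n)"


section \<open>Formal group laws\<close>

text \<open>
  A power series in \<open>x, y\<close> is an element of \<^typ>\<open>'k fps fps\<close>, the outer variable being \<open>y\<close>, and a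
  power series in \<open>x, y, z\<close> is an element of \<^typ>\<open>'k fps fps fps\<close>, the outer variable being \<open>z\<close>.
  Library composition of power series needs an inner series whose constant coefficient in the
  outer variable vanishes, which is not the case for a series such as \<open>x + y\<close>. The two
  substitutions below are meant for arguments with vanishing constant term (in all variables);
  then a product of \<open>m\<close> arguments has no monomials of total degree below \<open>m\<close>, and the finite sums
  contain all nonzero contributions.
\<close>

definition fps_subst2 :: "'k::comm_ring_1 fps \<Rightarrow> 'k fps fps \<Rightarrow> 'k fps fps" where
  "fps_subst2 g G = Abs_fps (\<lambda>b. Abs_fps (\<lambda>a.
     \<Sum>i\<le>a + b. fps_nth g i * fps_nth (fps_nth (G ^ i) b) a))"

definition fps2_subst3 ::
  "'k::comm_ring_1 fps fps \<Rightarrow> 'k fps fps fps \<Rightarrow> 'k fps fps fps \<Rightarrow> 'k fps fps fps" where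
  "fps2_subst3 F G H = Abs_fps (\<lambda>c. Abs_fps (\<lambda>b. Abs_fps (\<lambda>a.
     \<Sum>i\<le>a + b + c. \<Sum>j\<le>a + b + c.
       fps_nth (fps_nth F j) i * fps_nth (fps_nth (fps_nth (G ^ i * H ^ j) c) b) a)))"

text \<open>The conditions are \<open>F(x,0) = x\<close>, \<open>F(0,y) = y\<close> and \<open>F(F(x,y),z) = F(x,F(y,z))\<close>.\<close>

definition formal_group_law ::
  "('k::field_char_0 \<Rightarrow> int extended) \<Rightarrow> 'k fps fps \<Rightarrow> bool" where
  "formal_group_law \<nu> F \<longleftrightarrow>
     (\<forall>i j. fps_nth (fps_nth F j) i \<in> int_ring \<nu>) \<and>
     fps_nth F 0 = fps_X \<and>
     Abs_fps (\<lambda>j. fps_nth (fps_nth F j) 0) = fps_X \<and>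
     (let X = fps_const (fps_const fps_X); Y = fps_const fps_X; Z = fps_X
      in fps2_subst3 F (fps2_subst3 F X Y) Z = fps2_subst3 F X (fps2_subst3 F Y Z))"

text \<open>The defining equation is \<open>F(x,y) = f\<^sup>-\<^sup>1(f(x) + f(y))\<close>.\<close>

definition fgl_log :: "'k::field_char_0 fps fps \<Rightarrow> 'k fps" where
  "fgl_log F = (THE f. fps_nth f 0 = 0 \<and> fps_nth f 1 = 1 \<and>
     F = fps_subst2 (fps_inv f) (fps_subst2 f (fps_const fps_X) + fps_subst2 f fps_X))"


section \<open>Height and characteristic polynomial\<close>

definition frob_twist ::
  "nat \<Rightarrow> ('k::field_char_0 \<Rightarrow> int extended) \<Rightarrow> ('k \<Rightarrow> 'k) \<Rightarrow> nat \<Rightarrow> 'k fps \<Rightarrow> 'k fps" where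
  "frob_twist p \<nu> \<sigma> s f =
     Abs_fps (\<lambda>n. (frob_ext p \<nu> \<sigma> ^^ s) (fps_nth f n)) oo fps_X ^ (p ^ s)"

definition fps_integral_coeffs :: "('k::field_char_0 \<Rightarrow> int extended) \<Rightarrow> 'k fps \<Rightarrow> bool" where
  "fps_integral_coeffs \<nu> g \<longleftrightarrow> (\<forall>n. fps_nth g n \<in> int_ring \<nu>)"

text \<open>
  The series \<open>f(x) - (1/p) \<Sum> v\<^sub>s (\<sigma>\<^sup>s f)(x)\<close>, summed over all \<open>s \<ge> 1\<close>, is integral. Since \<open>f\<close> has
  no constant term, \<open>(\<sigma>\<^sup>s f)(x)\<close> is divisible by \<open>x\<close> to the power \<open>p\<^sup>s > s\<close>, so only the indices
  \<open>s \<le> n\<close> contribute to the coefficient of \<open>x\<^sup>n\<close>.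
\<close>

definition fgl_type ::
  "nat \<Rightarrow> ('k::field_char_0 \<Rightarrow> int extended) \<Rightarrow> ('k \<Rightarrow> 'k) \<Rightarrow> 'k fps fps \<Rightarrow> (nat \<Rightarrow> 'k) \<Rightarrow> bool"
where
  "fgl_type p \<nu> \<sigma> F v \<longleftrightarrow>
     (\<forall>s\<ge>1. v s \<in> int_ring \<nu>) \<and>
     fps_integral_coeffs \<nu>
       (fgl_log F - fps_const (1 / of_nat p) *
          Abs_fps (\<lambda>n. \<Sum>s=1..n. v s * fps_nth (frob_twist p \<nu> \<sigma> s (fgl_log F)) n))"

text \<open>
  Every formal group law has such a sequence \<open>v\<close>, and the height does not depend on it; hence
  the height is given by any one choice. The infimum of the empty set is \<open>\<infinity>\<close>.
\<close>

definition fgl_has_height ::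
  "nat \<Rightarrow> ('k::field_char_0 \<Rightarrow> int extended) \<Rightarrow> ('k \<Rightarrow> 'k) \<Rightarrow> 'k fps fps \<Rightarrow> enat \<Rightarrow> bool"
where
  "fgl_has_height p \<nu> \<sigma> F h \<longleftrightarrow>
     (\<exists>v. fgl_type p \<nu> \<sigma> F v \<and> h = Inf (enat ` {s. 1 \<le> s \<and> v s \<in> int_units \<nu>}))"

text \<open>\<open>\<Psi>\<close> is the characteristic polynomial of \<open>F\<close>, a formal group law of finite height \<open>h\<close>.\<close>

definition fgl_has_char_poly ::
  "nat \<Rightarrow> ('k::field_char_0 \<Rightarrow> int extended) \<Rightarrow> ('k \<Rightarrow> 'k) \<Rightarrow> 'k fps fps \<Rightarrow> nat \<Rightarrow> 'k poly \<Rightarrow> bool"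
where
  "fgl_has_char_poly p \<nu> \<sigma> F h \<Psi> \<longleftrightarrow>
     (\<exists>\<alpha>. (\<forall>i\<in>{1..<h}. \<exists>r\<in>int_ring \<nu>. \<alpha> i = of_nat p * r) \<and>
          \<alpha> h \<in> int_units \<nu> \<and>
          fps_integral_coeffs \<nu>
            (fgl_log F - fps_const (1 / of_nat p) *
               (\<Sum>s=1..h. fps_const (\<alpha> s) * frob_twist p \<nu> \<sigma> s (fgl_log F))) \<and>
          \<Psi> = [:of_nat p:] - (\<Sum>i=1..h. monom (\<alpha> i) i))"


section \<open>The elements \<open>\<beta>\<^sub>n\<close> and the matrices \<open>D\<^sub>k\<close>\<close>

definition fgl_beta :: "nat \<Rightarrow> (nat \<Rightarrow> 'k::field_char_0) \<Rightarrow> nat \<Rightarrow> nat \<Rightarrow> 'k" where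
  "fgl_beta p b h n = b (p ^ n - 1) / of_nat p ^ (n - n div h)"

definition fgl_D ::
  "nat \<Rightarrow> ('k \<Rightarrow> 'k) \<Rightarrow> (nat \<Rightarrow> 'k::field_char_0) \<Rightarrow> nat \<Rightarrow> nat \<Rightarrow> 'k mat" where
  "fgl_D p \<sigma> b h k = mat h h (\<lambda>(i, j).
     of_nat p ^ (if j < i \<or> j = h - 1 then 0 else 1) *
     (\<sigma> ^^ (j + 1)) (fgl_beta p b h (k * h - 1 + i - j)))"

end

theory Submission
  imports Defs "HOL-Computational_Algebra.Formal_Laurent_Series"
begin

text \<open>
  Let \<open>c\<^sub>n = b\<^bsub>p^n-1\<^esub> / p^n\<close> be the coefficient of \<open>x^(p^n)\<close> in the logarithm. Since \<open>\<sigma>\<^sup>s f\<close>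
  contributes to this coefficient only for \<open>s \<le> n\<close>, the integrality conditions defining the height
  and the characteristic polynomial become recursions modulo \<open>R\<close>,
  \<open>c\<^sub>n \<equiv> (1/p) \<Sum> v\<^sub>s \<sigma>\<^sup>s(c\<^bsub>n-s\<^esub>)\<close>. By induction \<open>c\<^sub>n\<close> has a pole of order at most
  \<open>\<lfloor>n/h\<rfloor>\<close>, and for \<open>h | n\<close> only the term \<open>s = h\<close> reaches this order, which gives
  \<open>\<beta>\<^bsub>kh\<^esub> \<equiv> v\<^sub>h \<sigma>\<^sup>h(\<beta>\<^bsub>(k-1)h\<^esub>)\<close> modulo \<open>p\<close>. The recursions with the coefficients \<open>\<alpha>\<^sub>s\<close> at
  \<open>n = kh, \<dots>, kh + h - 1\<close>, multiplied by \<open>p^k\<close>, are the linear system with matrix \<open>D\<^sub>k\<close> modulo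
  \<open>p^k\<close>.
\<close>

section \<open>The valuation, the ring of integers and its units\<close>

locale unramified_frobenius =
  fixes p :: nat
    and \<nu> :: "'k::field_char_0 \<Rightarrow> int extended"
    and \<sigma> :: "'k \<Rightarrow> 'k"
  assumes cdvf: "unramified_cdvf p \<nu>"
    and frob: "frobenius_lift p \<nu> \<sigma>"
begin

abbreviation R :: "'k set" where "R \<equiv> int_ring \<nu>"
abbreviation P :: 'k where "P \<equiv> of_nat p"
abbreviation cong :: "nat \<Rightarrow> 'k \<Rightarrow> 'k \<Rightarrow> bool" where "cong \<equiv> cong_ppow p \<nu>"
abbreviation \<phi> :: "'k \<Rightarrow> 'k" where "\<phi> \<equiv> frob_ext p \<nu> \<sigma>"

lemma prime_p: "prime p"
  and val_not_Minf: "\<nu> x \<noteq> Minf"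
  and val_Pinf_iff: "\<nu> x = Pinf \<longleftrightarrow> x = 0"
  and val_mult: "\<nu> (x * y) = \<nu> x + \<nu> y"
  and val_add: "min (\<nu> x) (\<nu> y) \<le> \<nu> (x + y)"
  and val_P: "\<nu> P = Fin 1"
  using cdvf unfolding unramified_cdvf_def by auto

lemma p_nonzero [simp]: "p \<noteq> 0"
  using prime_p prime_gt_0_nat by simp

lemma val_eq_Fin:
  assumes "x \<noteq> 0"
  obtains a where "\<nu> x = Fin a"
  using assms val_not_Minf[of x] val_Pinf_iff[of x] by (cases "\<nu> x") auto

lemma val_1: "\<nu> 1 = Fin 0"
proof -
  obtain a where "\<nu> 1 = Fin a"
    by (rule val_eq_Fin[of 1]) auto
  then show ?thesis
    using val_mult[of 1 1] by simp
qed

lemma val_uminus: "\<nu> (- x) = \<nu> x"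
proof -
  obtain a where a: "\<nu> (- 1) = Fin a"
    by (rule val_eq_Fin[of "- 1"]) auto
  then have "a = 0"
    using val_mult[of "- 1" "- 1"] val_1 by simp
  then show ?thesis
    using val_mult[of "- 1" x] a by (simp add: zero_extended_def[symmetric])
qed

lemma val_P_power: "\<nu> (P ^ n) = Fin (int n)"
  by (induction n) (auto simp: val_1 val_mult val_P)

lemma R_iff: "x \<in> R \<longleftrightarrow> Fin 0 \<le> \<nu> x"
  by (simp add: int_ring_def zero_extended_def)

lemma R_0 [simp, intro]: "0 \<in> R"
  using val_Pinf_iff[of 0] by (simp add: R_iff)

lemma R_1 [simp, intro]: "1 \<in> R"
  by (simp add: R_iff val_1)

lemma R_add [intro]: "x \<in> R \<Longrightarrow> y \<in> R \<Longrightarrow> x + y \<in> R"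
  using val_add[of x y] by (auto simp: R_iff min_def split: if_splits)

lemma R_mult [intro]: "x \<in> R \<Longrightarrow> y \<in> R \<Longrightarrow> x * y \<in> R"
  unfolding R_iff val_mult by (cases "\<nu> x"; cases "\<nu> y") auto

lemma R_uminus [intro]: "x \<in> R \<Longrightarrow> - x \<in> R"
  by (simp add: R_iff val_uminus)

lemma R_sum [intro]: "(\<And>i. i \<in> I \<Longrightarrow> f i \<in> R) \<Longrightarrow> sum f I \<in> R"
  by (induction I rule: infinite_finite_induct) auto

lemma R_prod [intro]: "(\<And>i. i \<in> I \<Longrightarrow> f i \<in> R) \<Longrightarrow> prod f I \<in> R"
  by (induction I rule: infinite_finite_induct) auto

lemma R_power [intro]: "x \<in> R \<Longrightarrow> x ^ n \<in> R"
  by (induction n) auto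

lemma R_of_nat [simp, intro]: "of_nat n \<in> R"
  by (induction n) auto

lemma R_P_power [simp, intro]: "P ^ n \<in> R"
  by (rule R_power) simp

text \<open>\<open>x\<close> and its inverse have opposite valuations, and both are nonnegative only
  if both vanish.\<close>

lemma val_unit_iff: "x \<in> int_units \<nu> \<longleftrightarrow> \<nu> x = Fin 0"
proof
  assume "x \<in> int_units \<nu>"
  then obtain y where "x \<in> R" "y \<in> R" "x * y = 1"
    by (auto simp: int_units_def)
  then have "Fin 0 \<le> \<nu> x" "Fin 0 \<le> \<nu> y" "\<nu> x + \<nu> y = Fin 0"
    using val_mult[of x y] by (auto simp: R_iff val_1)
  then show "\<nu> x = Fin 0"
    by (cases "\<nu> x"; cases "\<nu> y") auto
next
  assume x: "\<nu> x = Fin 0"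
  then have "x \<noteq> 0"
    using val_Pinf_iff[of x] by auto
  then obtain a where a: "\<nu> (1 / x) = Fin a"
    by (elim val_eq_Fin[of "1 / x", rotated]) simp
  have "x * (1 / x) = 1"
    using \<open>x \<noteq> 0\<close> by simp
  moreover have "a = 0"
    using val_mult[of x "1 / x"] x a \<open>x \<noteq> 0\<close> by (simp add: val_1)
  then have "1 / x \<in> R"
    using a by (simp add: R_iff)
  ultimately show "x \<in> int_units \<nu>"
    unfolding int_units_def using x by (auto simp: R_iff simp del: times_divide_eq_right)
qed

lemma unit_1 [simp]: "1 \<in> int_units \<nu>"
  by (simp add: val_unit_iff val_1)

lemma unit_mult: "x \<in> int_units \<nu> \<Longrightarrow> y \<in> int_units \<nu> \<Longrightarrow> x * y \<in> int_units \<nu>"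
  by (simp add: val_unit_iff val_mult)

lemma unit_uminus: "x \<in> int_units \<nu> \<Longrightarrow> - x \<in> int_units \<nu>"
  by (simp add: val_unit_iff val_uminus)

lemma unit_prod: "(\<And>i. i \<in> I \<Longrightarrow> f i \<in> int_units \<nu>) \<Longrightarrow> prod f I \<in> int_units \<nu>"
  by (induction I rule: infinite_finite_induct) (auto simp: unit_mult)

lemma unit_inverse:
  assumes "x \<in> int_units \<nu>"
  shows "x \<noteq> 0" "1 / x \<in> R"
proof -
  obtain y where y: "y \<in> R" "x * y = 1"
    using assms by (auto simp: int_units_def)
  then show "x \<noteq> 0"
    by auto
  then have "1 / x = y"
    using y by (simp add: field_simps)
  then show "1 / x \<in> R"
    using y by simp
qed

text \<open>Links valuation bounds to divisibility by \<open>P ^ n\<close>; the cofactor is the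
  quotient \<open>x / P ^ n\<close> taken in the field.\<close>

lemma val_ge_iff: "Fin (int n) \<le> \<nu> x \<longleftrightarrow> (\<exists>r\<in>R. x = P ^ n * r)"
proof
  assume *: "Fin (int n) \<le> \<nu> x"
  have "\<nu> x = Fin (int n) + \<nu> (x / P ^ n)"
    using val_mult[of "P ^ n" "x / P ^ n"] by (simp add: val_P_power)
  with * have "x / P ^ n \<in> R"
    unfolding R_iff by (cases "\<nu> (x / P ^ n)") auto
  then show "\<exists>r\<in>R. x = P ^ n * r"
    by (intro bexI[of _ "x / P ^ n"]) auto
next
  assume "\<exists>r\<in>R. x = P ^ n * r"
  then obtain r where "r \<in> R" "x = P ^ n * r"
    by blast
  then show "Fin (int n) \<le> \<nu> x"
    by (cases "\<nu> r") (auto simp: val_mult val_P_power R_iff)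
qed

section \<open>Congruences modulo powers of p\<close>

lemma cong_0_iff: "cong n x 0 \<longleftrightarrow> Fin (int n) \<le> \<nu> x"
  by (simp add: val_ge_iff cong_ppow_def)

lemma cong_iff_diff: "cong n x y \<longleftrightarrow> cong n (x - y) 0"
  by (simp add: cong_ppow_def)

text \<open>Finite valuations are integers, so a positive one is at least \<open>1\<close>: the
  maximal ideal is generated by \<open>P\<close>.\<close>

lemma non_unit_cong_0:
  assumes "x \<in> R" "x \<notin> int_units \<nu>"
  shows "cong 1 x 0"
  using assms unfolding cong_0_iff val_unit_iff R_iff by (cases "\<nu> x") auto

lemma unit_not_cong_0: "x \<in> int_units \<nu> \<Longrightarrow> \<not> cong 1 x 0"
  by (simp add: cong_0_iff val_unit_iff)

lemma cong_refl [simp, intro]: "cong n x x"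
  unfolding cong_ppow_def by (rule bexI[of _ 0]) auto

lemma cong_P_power: "r \<in> R \<Longrightarrow> n \<le> k \<Longrightarrow> cong n (P ^ k * r) 0"
  unfolding cong_0_iff by (cases "\<nu> r") (auto simp: val_mult val_P_power R_iff)

lemma cong_add:
  assumes "cong n x y" "cong n x' y'"
  shows "cong n (x + x') (y + y')"
proof -
  obtain r s where "r \<in> R" "x - y = P ^ n * r" "s \<in> R" "x' - y' = P ^ n * s"
    using assms unfolding cong_ppow_def by blast
  then have "(x + x') - (y + y') = P ^ n * (r + s)" "r + s \<in> R"
    by (simp_all only: add_diff_add distrib_left R_add)
  then show ?thesis
    unfolding cong_ppow_def by blast
qed

lemma cong_sym:
  assumes "cong n x y"
  shows "cong n y x"
proof -
  obtain r where "r \<in> R" "x - y = P ^ n * r"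
    using assms unfolding cong_ppow_def by blast
  then have "y - x = P ^ n * (- r)" "- r \<in> R"
    by (simp_all add: R_uminus flip: minus_diff_eq[of x y])
  then show ?thesis
    unfolding cong_ppow_def by blast
qed

lemma cong_trans [trans]: "cong n x y \<Longrightarrow> cong n y z \<Longrightarrow> cong n x z"
  using cong_add[of n "x - y" 0 "y - z" 0] cong_iff_diff[of n x y] cong_iff_diff[of n y z]
    cong_iff_diff[of n x z] by simp

lemma cong_mult_left:
  assumes "cong n x y" "z \<in> R"
  shows "cong n (z * x) (z * y)"
proof -
  obtain r where r: "r \<in> R" "x - y = P ^ n * r"
    using assms unfolding cong_ppow_def by blast
  have "z * x - z * y = z * (x - y)"
    by (simp add: right_diff_distrib)
  also have "\<dots> = P ^ n * (z * r)"
    unfolding r(2) by (simp add: mult.left_commute)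
  finally show ?thesis
    unfolding cong_ppow_def using R_mult[OF assms(2) r(1)] by blast
qed

text \<open>The factors are exchanged one at a time, via \<open>x * y'\<close>, so only
  \<open>x\<close> and \<open>y'\<close> have to be integral.\<close>

lemma cong_mult:
  assumes "cong n x y" "cong n x' y'" "x \<in> R" "y' \<in> R"
  shows "cong n (x * x') (y * y')"
  using cong_trans[OF cong_mult_left[OF assms(2,3)]] cong_mult_left[OF assms(1,4)]
  by (simp add: mult.commute)

lemma cong_sum: "(\<And>i. i \<in> I \<Longrightarrow> cong n (f i) (g i)) \<Longrightarrow> cong n (sum f I) (sum g I)"
  by (induction I rule: infinite_finite_induct) (auto intro: cong_add)

lemma cong_prod:
  assumes "\<And>i. i \<in> I \<Longrightarrow> cong n (f i) (g i)"
    and "\<And>i. i \<in> I \<Longrightarrow> f i \<in> R" "\<And>i. i \<in> I \<Longrightarrow> g i \<in> R"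
  shows "cong n (prod f I) (prod g I)"
  using assms by (induction I rule: infinite_finite_induct) (auto intro!: cong_mult)

text \<open>Being a unit is visible modulo p: otherwise \<open>y\<close>, and with it
  \<open>x\<close>, would be congruent to \<open>0\<close>.\<close>

lemma unit_cong:
  assumes "x \<in> int_units \<nu>" "cong 1 y x" "y \<in> R"
  shows "y \<in> int_units \<nu>"
proof (rule ccontr)
  assume "y \<notin> int_units \<nu>"
  then have "cong 1 x 0"
    by (rule cong_trans[OF cong_sym[OF assms(2)] non_unit_cong_0[OF assms(3)]])
  then show False
    using unit_not_cong_0[OF assms(1)] by blast
qed

section \<open>The Frobenius lift and its linear extension\<close>

lemma sigma_R: "x \<in> R \<Longrightarrow> \<sigma> x \<in> R"
  and sigma_1: "\<sigma> 1 = 1"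
  and sigma_add: "x \<in> R \<Longrightarrow> y \<in> R \<Longrightarrow> \<sigma> (x + y) = \<sigma> x + \<sigma> y"
  and sigma_mult: "x \<in> R \<Longrightarrow> y \<in> R \<Longrightarrow> \<sigma> (x * y) = \<sigma> x * \<sigma> y"
  using frob unfolding frobenius_lift_def by auto

lemma sigma_of_nat: "\<sigma> (of_nat n) = of_nat n"
proof (induction n)
  case 0
  then show ?case using sigma_add[of 0 0] by simp
next
  case (Suc n)
  then show ?case using sigma_add[of 1 "of_nat n"] sigma_1 by simp
qed

lemma sigma_pow_R [intro]: "x \<in> R \<Longrightarrow> (\<sigma> ^^ s) x \<in> R"
  by (induction s) (auto simp: sigma_R)

lemma sigma_pow_1: "(\<sigma> ^^ s) 1 = 1"
  by (induction s) (auto simp: sigma_1)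

lemma sigma_pow_add: "x \<in> R \<Longrightarrow> y \<in> R \<Longrightarrow> (\<sigma> ^^ s) (x + y) = (\<sigma> ^^ s) x + (\<sigma> ^^ s) y"
  by (induction s) (auto simp: sigma_add sigma_pow_R)

lemma sigma_pow_mult: "x \<in> R \<Longrightarrow> y \<in> R \<Longrightarrow> (\<sigma> ^^ s) (x * y) = (\<sigma> ^^ s) x * (\<sigma> ^^ s) y"
  by (induction s) (auto simp: sigma_mult sigma_pow_R)

lemma sigma_pow_prod:
  "(\<And>i. i \<in> I \<Longrightarrow> f i \<in> R) \<Longrightarrow> (\<sigma> ^^ s) (prod f I) = (\<Prod>i\<in>I. (\<sigma> ^^ s) (f i))"
  by (induction I rule: infinite_finite_induct) (auto simp: sigma_pow_1 sigma_pow_mult R_prod)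

lemma sigma_pow_P_power: "(\<sigma> ^^ s) (P ^ n) = P ^ n"
proof -
  have "\<sigma> (P ^ n) = P ^ n"
    using sigma_of_nat[of "p ^ n"] by simp
  then show ?thesis
    by (induction s) auto
qed

lemma sigma_pow_unit:
  assumes "x \<in> int_units \<nu>"
  shows "(\<sigma> ^^ s) x \<in> int_units \<nu>"
proof -
  obtain y where "x \<in> R" "y \<in> R" "x * y = 1"
    using assms by (auto simp: int_units_def)
  then show ?thesis
    using sigma_pow_mult[of x y s] unfolding int_units_def by (auto simp: sigma_pow_1)
qed

lemma sigma_pow_cong:
  assumes "cong n x y" "y \<in> R"
  shows "cong n ((\<sigma> ^^ s) x) ((\<sigma> ^^ s) y)"
proof -
  obtain r where r: "r \<in> R" "x - y = P ^ n * r"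
    using assms(1) unfolding cong_ppow_def by blast
  then have "x = P ^ n * r + y"
    by (simp add: algebra_simps)
  then have "(\<sigma> ^^ s) x - (\<sigma> ^^ s) y = P ^ n * (\<sigma> ^^ s) r"
    using r assms(2) by (simp add: sigma_pow_add sigma_pow_mult sigma_pow_P_power R_mult)
  then show ?thesis
    unfolding cong_ppow_def using r by blast
qed

text \<open>Any denominator \<open>P ^ t\<close> may replace the least one of the definition,
  because the surplus factor \<open>P ^ (t - n)\<close> is fixed by \<open>\<sigma>\<close> and
  cancels.\<close>

lemma frob_ext_eq:
  assumes "P ^ t * x \<in> R"
  shows "\<phi> x = \<sigma> (P ^ t * x) / P ^ t"
proof -
  define n where "n = (LEAST n. P ^ n * x \<in> R)"
  have n: "P ^ n * x \<in> R" "n \<le> t"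
    unfolding n_def using assms by (auto intro: LeastI Least_le)
  have t: "P ^ t = P ^ (t - n) * P ^ n"
    using n by (simp add: power_add[symmetric])
  moreover have "\<sigma> (P ^ t * x) = P ^ (t - n) * \<sigma> (P ^ n * x)"
    unfolding t using n sigma_mult[of "P ^ (t - n)" "P ^ n * x"] sigma_pow_P_power[of 1 "t - n"]
    by (simp add: mult.assoc)
  ultimately show ?thesis
    unfolding frob_ext_def Let_def n_def[symmetric] by simp
qed

text \<open>One denominator serves for every iterate, since \<open>P ^ t * (\<phi> ^^ s) x\<close>
  stays integral.\<close>

lemma frob_ext_pow_eq:
  assumes "P ^ t * x \<in> R"
  shows "(\<phi> ^^ s) x = (\<sigma> ^^ s) (P ^ t * x) / P ^ t"
proof (induction s)
  case (Suc s)
  have "P ^ t * (\<phi> ^^ s) x = (\<sigma> ^^ s) (P ^ t * x)"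
    using Suc by simp
  then show ?case
    using frob_ext_eq[of t "(\<phi> ^^ s) x"] sigma_pow_R[OF assms, of s] by simp
qed simp

lemma frob_ext_pow_R: "x \<in> R \<Longrightarrow> (\<phi> ^^ s) x \<in> R"
  using frob_ext_pow_eq[of 0 x s] by auto

section \<open>Recursions for the coefficients of the logarithm at powers of p\<close>

text \<open>Substituting \<open>fps_X ^ (p ^ s)\<close> leaves only exponents divisible by
  \<open>p ^ s\<close>.\<close>

lemma frob_twist_nth_prime_power:
  "fps_nth (frob_twist p \<nu> \<sigma> s f) (p ^ n) =
     (if s \<le> n then (\<phi> ^^ s) (fps_nth f (p ^ (n - s))) else 0)"
proof -
  have "p ^ s dvd p ^ n \<longleftrightarrow> s \<le> n"
    using prime_gt_1_nat[OF prime_p] by (simp add: dvd_power_iff_le)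
  moreover have "p ^ n div p ^ s = p ^ (n - s)" if "s \<le> n"
    using that by (simp add: power_diff)
  ultimately show ?thesis
    unfolding frob_twist_def by (simp add: fps_nth_compose_X_power)
qed

lemma type_recursion:
  assumes "fgl_type p \<nu> \<sigma> F v"
  shows "fps_nth (fgl_log F) (p ^ n)
    - (\<Sum>s=1..n. v s * (\<phi> ^^ s) (fps_nth (fgl_log F) (p ^ (n - s)))) / P \<in> R"
proof -
  let ?t = "\<lambda>s. v s * fps_nth (frob_twist p \<nu> \<sigma> s (fgl_log F)) (p ^ n)"
  have "n \<le> p ^ n"
    using prime_gt_1_nat[OF prime_p] by (simp add: less_imp_le)
  \<comment> \<open>The terms with \<open>s > n\<close> vanish at the exponent
    \<open>p ^ n\<close>.\<close>
  then have "sum ?t {1..p ^ n} = sum ?t {1..n}"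
    by (intro sum.mono_neutral_right) (auto simp: frob_twist_nth_prime_power)
  also have "\<dots> = (\<Sum>s=1..n. v s * (\<phi> ^^ s) (fps_nth (fgl_log F) (p ^ (n - s))))"
    by (intro sum.cong) (auto simp: frob_twist_nth_prime_power)
  finally have "sum ?t {1..p ^ n} = \<dots>" .
  moreover have "fps_nth (fgl_log F) (p ^ n) - sum ?t {1..p ^ n} / P \<in> R"
    using assms unfolding fgl_type_def fps_integral_coeffs_def
    by (auto dest: spec[of _ "p ^ n"] simp del: One_nat_def)
  ultimately show ?thesis by simp
qed

lemma char_poly_recursion:
  assumes "fgl_has_char_poly p \<nu> \<sigma> F m ([:P:] - (\<Sum>i=1..m. monom (\<alpha> i) i))"
    and "m \<le> n"
  shows "fps_nth (fgl_log F) (p ^ n)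
      - (\<Sum>s=1..m. \<alpha> s * (\<phi> ^^ s) (fps_nth (fgl_log F) (p ^ (n - s)))) / P \<in> R"
proof -
  obtain \<gamma> where int: "fps_integral_coeffs \<nu> (fgl_log F - fps_const (1 / P) *
               (\<Sum>s=1..m. fps_const (\<gamma> s) * frob_twist p \<nu> \<sigma> s (fgl_log F)))"
    and eq: "[:P:] - (\<Sum>i=1..m. monom (\<alpha> i) i) = [:P:] - (\<Sum>i=1..m. monom (\<gamma> i) i)"
    using assms unfolding fgl_has_char_poly_def by blast
  \<comment> \<open>The polynomial determines its coefficients in degrees \<open>1\<close> to
    \<open>m\<close>, so the witness \<open>\<gamma>\<close> hidden in the definition agrees with
    the given \<open>\<alpha>\<close> there.\<close>
  have "coeff (\<Sum>i=1..m. monom (\<delta> i) i) j = \<delta> j" if "1 \<le> j" "j \<le> m" for \<delta> :: "nat \<Rightarrow> 'k" and j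
    using that by (simp add: coeff_sum)
  moreover have "(\<Sum>i=1..m. monom (\<alpha> i) i) = (\<Sum>i=1..m. monom (\<gamma> i) i)"
    using eq by simp
  ultimately have same: "\<alpha> j = \<gamma> j" if "1 \<le> j" "j \<le> m" for j
    using that by metis
  have "fps_nth (fgl_log F) (p ^ n)
      - (\<Sum>s=1..m. \<gamma> s * fps_nth (frob_twist p \<nu> \<sigma> s (fgl_log F)) (p ^ n)) / P \<in> R"
    using int unfolding fps_integral_coeffs_def
    by (auto dest: spec[of _ "p ^ n"] simp: fps_sum_nth simp del: One_nat_def)
  also have "(\<Sum>s=1..m. \<gamma> s * fps_nth (frob_twist p \<nu> \<sigma> s (fgl_log F)) (p ^ n))
    = (\<Sum>s=1..m. \<alpha> s * (\<phi> ^^ s) (fps_nth (fgl_log F) (p ^ (n - s))))"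
    using assms(2) by (intro sum.cong) (auto simp: frob_twist_nth_prime_power same)
  finally show "fps_nth (fgl_log F) (p ^ n)
      - (\<Sum>s=1..m. \<alpha> s * (\<phi> ^^ s) (fps_nth (fgl_log F) (p ^ (n - s)))) / P \<in> R" .
qed

section \<open>Determinants and inverses over the ring of integers\<close>

lemma det_R:
  assumes "A \<in> carrier_mat n n" "\<And>i j. i < n \<Longrightarrow> j < n \<Longrightarrow> A $$ (i, j) \<in> R"
  shows "det A \<in> R"
  unfolding det_def'[OF assms(1)] using assms(2)
  by (intro R_sum R_mult R_prod) (auto simp: sign_def permutes_in_image)

text \<open>The Leibniz formula uses only sums, products and signs, all of which respect congruences
  of integral elements.\<close>

lemma det_cong:
  assumes "A \<in> carrier_mat n n" "B \<in> carrier_mat n n"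
    and "\<And>i j. i < n \<Longrightarrow> j < n \<Longrightarrow> A $$ (i, j) \<in> R"
    and "\<And>i j. i < n \<Longrightarrow> j < n \<Longrightarrow> B $$ (i, j) \<in> R"
    and "\<And>i j. i < n \<Longrightarrow> j < n \<Longrightarrow> cong k (A $$ (i, j)) (B $$ (i, j))"
  shows "cong k (det A) (det B)"
  unfolding det_def'[OF assms(1)] det_def'[OF assms(2)] using assms(3-5)
  by (intro cong_sum cong_mult_left cong_prod) (auto simp: sign_def permutes_in_image)

text \<open>Cramer's rule: the entries of the adjugate are integral minors up to sign, and dividing
  by a unit keeps them integral.\<close>

lemma integral_inverse_mat:
  assumes A: "A \<in> carrier_mat n n"
    and int: "\<And>i j. i < n \<Longrightarrow> j < n \<Longrightarrow> A $$ (i, j) \<in> R"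
    and unit: "det A \<in> int_units \<nu>"
  obtains E where "E \<in> carrier_mat n n" "inverts_mat A E" "inverts_mat E A"
    "\<And>i j. i < n \<Longrightarrow> j < n \<Longrightarrow> E $$ (i, j) \<in> R"
proof
  let ?E = "(1 / det A) \<cdot>\<^sub>m adj_mat A"
  note adj = adj_mat[OF A]
  have d: "det A \<noteq> 0" "1 / det A \<in> R"
    using unit_inverse[OF unit] by blast+
  show E: "?E \<in> carrier_mat n n"
    using adj(1) by simp
  show "inverts_mat A ?E" "inverts_mat ?E A"
    using A adj d by (auto simp: inverts_mat_def mult_smult_distrib[OF A adj(1)]
        mult_smult_assoc_mat[OF adj(1) A])
  fix i j assume ij: "i < n" "j < n"
  have "det (mat_delete A j i) \<in> R"
    using A ij by (intro det_R[of _ "n - 1"])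
      (auto simp: mat_delete_def int)
  then have "adj_mat A $$ (i, j) \<in> R"
    using A ij by (auto simp: adj_mat_def cofactor_def intro!: R_mult R_power)
  then show "?E $$ (i, j) \<in> R"
    using R_mult[OF d(2)] adj(1) ij by simp
qed

end

section \<open>Index arithmetic: residue classes and quotients\<close>

text \<open>Sorts the exponents by residue modulo \<open>m\<close>: the first product takes the
  multiples of \<open>m\<close>, the others the classes of \<open>Suc j\<close>. This collects the
  conjugates of \<open>\<beta> m\<close> in the determinant.\<close>

lemma prod_residue_classes:
  fixes g :: "nat \<Rightarrow> 'a::comm_monoid_mult"
  assumes "k \<ge> 1" "m \<ge> 1"
  shows "(\<Prod>i<k - 1. g (i * m + m)) * (\<Prod>j<m - 1. \<Prod>i<k. g (i * m + Suc j))
    = (\<Prod>s=1..k * m - 1. g s)"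
proof -
  obtain k' m' where km: "k = Suc k'" "m = Suc m'"
    using assms by (metis Suc_le_D One_nat_def)
  \<comment> \<open>The value \<open>1\<close> at \<open>0\<close> completes the class of multiples
    of \<open>m\<close>, so that the indices fill all of \<open>{..<k * m}\<close>.\<close>
  define f where "f s = (if s = 0 then 1 else g s)" for s
  have "(\<Prod>i<k. f (i * m)) * (\<Prod>j<m'. \<Prod>i<k. f (i * m + Suc j)) = (\<Prod>j<m. \<Prod>i<k. f (i * m + j))"
    unfolding km(2) by (simp add: prod.lessThan_Suc_shift del: prod.lessThan_Suc)
  also have "\<dots> = (\<Prod>i<k. \<Prod>j<m. f (i * m + j))"
    by (rule prod.swap)
  also have "\<dots> = (\<Prod>i<k. prod f {i * m..<i * m + m})"
    by (subst prod.atLeastLessThan_shift_0) (simp add: lessThan_atLeast0)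
  also have "\<dots> = prod f {..<k * m}"
    by (rule prod.nat_group)
  also have "\<dots> = prod f {1..k * m - 1}"
    using assms by (intro prod.mono_neutral_right) (auto simp: f_def)
  also have "\<dots> = prod g {1..k * m - 1}"
    by (intro prod.cong) (auto simp: f_def)
  also have "(\<Prod>i<k. f (i * m)) = (\<Prod>i<k - 1. g (i * m + m))"
    unfolding km by (simp add: prod.lessThan_Suc_shift f_def algebra_simps del: prod.lessThan_Suc)
  also have "(\<Prod>j<m'. \<Prod>i<k. f (i * m + Suc j)) = (\<Prod>j<m - 1. \<Prod>i<k. g (i * m + Suc j))"
    unfolding km by (simp add: f_def)
  finally show ?thesis .
qed

text \<open>The division by p in the recursion costs one power. The first bound pays for it when
  \<open>s \<ge> m\<close>; the second leaves a spare factor p when \<open>m\<close> divides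
  \<open>n\<close> and \<open>s > m\<close>.\<close>

lemma div_gap:
  fixes m n s :: nat
  assumes "1 \<le> m" "m \<le> s" "s \<le> n"
  shows "(n - s) div m < n div m"
    and "m dvd n \<Longrightarrow> m < s \<Longrightarrow> Suc ((n - s) div m) < n div m"
proof -
  have "(n - s) div m \<le> (n - m) div m"
    using assms by (intro div_le_mono) auto
  moreover have "(n - m) div m = n div m - 1" "n div m \<ge> 1"
    using assms by (auto simp: le_div_geq)
  ultimately show "(n - s) div m < n div m"
    by linarith
  assume *: "m dvd n" "m < s"
  then obtain q where q: "n = m * q" by blast
  have "(n - s) div m < q - 1"
    using * assms(1,3) unfolding q
    by (simp add: div_less_iff_less_mult algebra_simps)
  then show "Suc ((n - s) div m) < n div m"
    using q assms(1) by simp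
qed

text \<open>This drop of the quotient makes the summands with \<open>s < m\<close> vanish modulo p
  when \<open>m\<close> divides \<open>n\<close>.\<close>

lemma div_gap_dvd:
  fixes m n s :: nat
  assumes "1 \<le> m" "1 \<le> s" "s \<le> n" "m dvd n"
  shows "(n - s) div m < n div m"
  using assms by (auto elim!: dvdE simp: div_less_iff_less_mult algebra_simps)

section \<open>Infinite height\<close>

text \<open>Every \<open>u s / P\<close> is integral, so strong induction propagates integrality
  along the recursion.\<close>

lemma (in unramified_frobenius) infinite_height_integral:
  assumes rec: "\<And>n. c n - (\<Sum>s=1..n. u s * (\<phi> ^^ s) (c (n - s))) / P \<in> R"
    and u: "\<And>s. 1 \<le> s \<Longrightarrow> cong 1 (u s) 0"
  shows "c n \<in> R"
proof (induction n rule: less_induct)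
  case (less n)
  have "u s * (\<phi> ^^ s) (c (n - s)) / P \<in> R" if "s \<in> {1..n}" for s
  proof -
    obtain r where "r \<in> R" "u s = P * r"
      using u[of s] \<open>s \<in> {1..n}\<close> by (auto simp: cong_ppow_def)
    moreover have "(\<phi> ^^ s) (c (n - s)) \<in> R"
      using that by (intro frob_ext_pow_R less) auto
    ultimately show ?thesis
      by (simp add: R_mult)
  qed
  then have "(\<Sum>s=1..n. u s * (\<phi> ^^ s) (c (n - s))) / P \<in> R"
    unfolding sum_divide_distrib by (rule R_sum)
  from R_add[OF rec[of n] this] show ?case by simp
qed

section \<open>Finite height: integrality and congruences of the elements
  \<open>\<beta> n\<close>\<close>

text \<open>To be used with \<open>u\<close> a sequence defining the height, \<open>c n\<close> the
  coefficient of \<open>x^(p^n)\<close> in the logarithm and \<open>m\<close> the height.\<close>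

locale finite_height_recursion = unramified_frobenius p \<nu> \<sigma>
  for p :: nat and \<nu> :: "'k::field_char_0 \<Rightarrow> int extended" and \<sigma> :: "'k \<Rightarrow> 'k" +
  fixes u c :: "nat \<Rightarrow> 'k" and m :: nat
  assumes m_pos: "1 \<le> m"
    and c_0: "c 0 = 1"
    and u_R: "1 \<le> s \<Longrightarrow> u s \<in> R"
    and u_cong_0: "1 \<le> s \<Longrightarrow> s < m \<Longrightarrow> cong 1 (u s) 0"
    and u_unit: "u m \<in> int_units \<nu>"
    and recursion: "c n - (\<Sum>s=1..n. u s * (\<phi> ^^ s) (c (n - s))) / P \<in> R"
begin

text \<open>With \<open>c n\<close> equal to \<open>b (p ^ n - 1) / P ^ n\<close> this is
  \<open>fgl_beta p b m n\<close>; its integrality bounds the pole order of \<open>c n\<close> by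
  \<open>n div m\<close>.\<close>

definition \<beta> :: "nat \<Rightarrow> 'k" where "\<beta> n = P ^ (n div m) * c n"

lemma beta_0: "\<beta> 0 = 1"
  by (simp add: \<beta>_def c_0)

text \<open>\<open>P ^ ((n - s) div m)\<close> is a denominator of \<open>c (n - s)\<close> and
  passes through the twist; the exponent left over is the drop of the quotient.\<close>

lemma scaled_twist:
  assumes "\<beta> (n - s) \<in> R"
  shows "P ^ (n div m) * (\<phi> ^^ s) (c (n - s)) = P ^ (n div m - (n - s) div m) * (\<sigma> ^^ s) (\<beta> (n - s))"
proof -
  have "P ^ (n div m) = P ^ (n div m - (n - s) div m) * P ^ ((n - s) div m)"
    by (simp add: power_add[symmetric] div_le_mono)
  then show ?thesis
    using frob_ext_pow_eq[of "(n - s) div m" "c (n - s)" s] assms by (simp add: \<beta>_def)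
qed

text \<open>A term of the recursion scaled by \<open>P ^ (n div m)\<close>, the factor that turns
  \<open>c n\<close> into \<open>\<beta> n\<close>.\<close>

definition summand :: "nat \<Rightarrow> nat \<Rightarrow> 'k" where
  "summand n s = u s / P * (P ^ (n div m) * (\<phi> ^^ s) (c (n - s)))"

lemma beta_recursion: "\<exists>r\<in>R. \<beta> n = P ^ (n div m) * r + (\<Sum>s=1..n. summand n s)"
proof (rule bexI[OF _ recursion[of n]])
  have "(\<Sum>s=1..n. summand n s) = P ^ (n div m) * ((\<Sum>s=1..n. u s * (\<phi> ^^ s) (c (n - s))) / P)"
    by (simp add: summand_def sum_distrib_left sum_divide_distrib mult_ac)
  then show "\<beta> n = P ^ (n div m) * (c n - (\<Sum>s=1..n. u s * (\<phi> ^^ s) (c (n - s))) / P)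
      + (\<Sum>s=1..n. summand n s)"
    by (simp add: \<beta>_def right_diff_distrib)
qed

text \<open>For \<open>s < m\<close> the factor p in \<open>u s\<close> cancels the division by p;
  for \<open>s \<ge> m\<close> one power from the drop of the quotient is spent on it. The last
  clause keeps the exact value at \<open>s = m\<close>.\<close>

lemma summand_eq:
  assumes s: "1 \<le> s" "s \<le> n" and beta: "\<beta> (n - s) \<in> R"
  obtains r where "r \<in> R" "s < m \<Longrightarrow> summand n s = P ^ (n div m - (n - s) div m) * r"
    "m \<le> s \<Longrightarrow> summand n s = P ^ (n div m - Suc ((n - s) div m)) * r"
    "s = m \<Longrightarrow> r = u m * (\<sigma> ^^ m) (\<beta> (n - m))"
proof (cases "s < m")
  case True
  then obtain r where "r \<in> R" "u s = P * r"
    using u_cong_0[of s] s by (auto simp: cong_ppow_def)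
  then show ?thesis
    using True beta by (intro that[of "r * (\<sigma> ^^ s) (\<beta> (n - s))"])
      (auto simp: summand_def scaled_twist)
next
  case False
  then have "n div m - (n - s) div m = Suc (n div m - Suc ((n - s) div m))"
    using div_gap(1)[of m s n] m_pos s by simp
  then show ?thesis
    using False beta u_R[OF s(1)] by (intro that[of "u s * (\<sigma> ^^ s) (\<beta> (n - s))"])
      (auto simp: summand_def scaled_twist)
qed

lemma beta_R: "\<beta> n \<in> R"
proof (induction n rule: less_induct)
  case (less n)
  have "summand n s \<in> R" if s: "s \<in> {1..n}" for s
  proof -
    have "\<beta> (n - s) \<in> R"
      using s by (intro less) auto
    then obtain r where "r \<in> R" "s < m \<Longrightarrow> summand n s = P ^ (n div m - (n - s) div m) * r"
      "m \<le> s \<Longrightarrow> summand n s = P ^ (n div m - Suc ((n - s) div m)) * r"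
      using summand_eq[of s n] s by (metis atLeastAtMost_iff)
    then show ?thesis
      by (cases "s < m") (auto intro!: R_mult)
  qed
  then have "(\<Sum>s=1..n. summand n s) \<in> R"
    by (rule R_sum)
  moreover obtain r where "r \<in> R" "\<beta> n = P ^ (n div m) * r + (\<Sum>s=1..n. summand n s)"
    using beta_recursion by blast
  ultimately show ?case
    by (simp add: R_add R_mult)
qed

text \<open>At a multiple of \<open>m\<close> all summands except \<open>s = m\<close> carry a spare
  factor p, and so does the integral error scaled by \<open>P ^ Suc k\<close>.\<close>

lemma beta_step: "cong 1 (\<beta> (Suc k * m)) (u m * (\<sigma> ^^ m) (\<beta> (k * m)))"
proof -
  define n where "n = Suc k * m"
  have n: "m dvd n" "m \<le> n" "n - m = k * m" "n div m = Suc k"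
    using m_pos by (auto simp: n_def)
  have "cong 1 (summand n s) 0" if s: "s \<in> {1..n} - {m}" for s
  proof -
    have s': "1 \<le> s" "s \<le> n" "s \<noteq> m"
      using s by auto
    obtain r where r: "r \<in> R" "s < m \<Longrightarrow> summand n s = P ^ (n div m - (n - s) div m) * r"
      "m \<le> s \<Longrightarrow> summand n s = P ^ (n div m - Suc ((n - s) div m)) * r"
      using summand_eq[OF s'(1,2) beta_R] by metis
    have "(n - s) div m < n div m" "m < s \<Longrightarrow> Suc ((n - s) div m) < n div m"
      using div_gap_dvd[OF m_pos s'(1,2) n(1)] div_gap(2)[OF m_pos _ s'(2) n(1)] by auto
    then show ?thesis
      using r s' by (cases "s < m") (auto intro!: cong_P_power)
  qed
  then have "cong 1 (sum (summand n) ({1..n} - {m})) (\<Sum>s\<in>{1..n} - {m}. 0)"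
    by (rule cong_sum)
  then have rest: "cong 1 (sum (summand n) ({1..n} - {m})) 0"
    by simp
  have "summand n m = u m * (\<sigma> ^^ m) (\<beta> (k * m))"
    using summand_eq[OF m_pos n(2) beta_R, of "summand n m = u m * (\<sigma> ^^ m) (\<beta> (k * m))"] n m_pos
    by simp
  then have "(\<Sum>s=1..n. summand n s)
      = sum (summand n) ({1..n} - {m}) + u m * (\<sigma> ^^ m) (\<beta> (k * m))"
    using n m_pos by (subst sum.remove[of _ m]) auto
  moreover obtain r where "r \<in> R" "\<beta> n = P ^ (n div m) * r + (\<Sum>s=1..n. summand n s)"
    using beta_recursion by blast
  ultimately obtain r where r: "r \<in> R" and "\<beta> n = (P ^ Suc k * r
      + sum (summand n) ({1..n} - {m})) + u m * (\<sigma> ^^ m) (\<beta> (k * m))"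
    by (auto simp: n add.assoc)
  moreover have "cong 1 ((P ^ Suc k * r + sum (summand n) ({1..n} - {m}))
      + u m * (\<sigma> ^^ m) (\<beta> (k * m))) (0 + 0 + u m * (\<sigma> ^^ m) (\<beta> (k * m)))"
    using r by (intro cong_add rest cong_refl cong_P_power) auto
  ultimately show ?thesis
    by (simp add: n_def)
qed

text \<open>Starting from \<open>\<beta> 0 = 1\<close>, each step modulo p applies
  \<open>\<sigma> ^^ m\<close>, which preserves units, and multiplies by the unit
  \<open>u m\<close>.\<close>

lemma beta_unit: "\<beta> (k * m) \<in> int_units \<nu>"
proof (induction k)
  case (Suc k)
  show ?case
    by (rule unit_cong[OF unit_mult[OF u_unit sigma_pow_unit[OF Suc]] beta_step beta_R])
qed (simp add: beta_0)

lemma beta_height_cong: "cong 1 (\<beta> m) (u m)"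
  using beta_step[of 0] by (simp add: beta_0 sigma_pow_1)

text \<open>Iterates \<open>beta_step\<close> with \<open>u m\<close> replaced by
  \<open>\<beta> m\<close>, which is congruent to it.\<close>

lemma beta_multiple_cong: "cong 1 (\<beta> (k * m)) (\<Prod>i<k. (\<sigma> ^^ (i * m)) (\<beta> m))"
proof (induction k)
  case 0
  then show ?case by (simp add: beta_0)
next
  case (Suc k)
  have prod_R: "(\<Prod>i<k. (\<sigma> ^^ (i * m)) (\<beta> m)) \<in> R"
    by (intro R_prod sigma_pow_R beta_R)
  have "cong 1 (u m * (\<sigma> ^^ m) (\<beta> (k * m))) (\<beta> m * (\<sigma> ^^ m) (\<Prod>i<k. (\<sigma> ^^ (i * m)) (\<beta> m)))"
    using Suc prod_R
    by (intro cong_mult sigma_pow_cong cong_sym[OF beta_height_cong]) (auto intro: u_R m_pos)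
  \<comment> \<open>\<open>\<sigma> ^^ m\<close> raises each index \<open>i\<close> by one; the new
    factor \<open>\<beta> m\<close> takes the free place \<open>i = 0\<close>.\<close>
  also have "(\<sigma> ^^ m) (\<Prod>i<k. (\<sigma> ^^ (i * m)) (\<beta> m)) = (\<Prod>i<k. (\<sigma> ^^ (Suc i * m)) (\<beta> m))"
    by (subst sigma_pow_prod) (auto simp: funpow_add beta_R sigma_pow_R)
  also have "\<beta> m * \<dots> = (\<Prod>i<Suc k. (\<sigma> ^^ (i * m)) (\<beta> m))"
    by (simp only: prod.lessThan_Suc_shift) simp
  finally show ?case
    using beta_step cong_trans by blast
qed

section \<open>The matrices \<open>D k\<close> and their determinants\<close>

text \<open>\<open>fgl_D\<close> written with \<open>\<beta>\<close>. For \<open>k \<ge> 1\<close>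
  and \<open>j < m\<close> the subtractions in the index do not truncate.\<close>

definition D :: "nat \<Rightarrow> 'k mat" where
  "D k = mat m m (\<lambda>(i, j). P ^ (if j < i \<or> j = m - 1 then 0 else 1) *
     (\<sigma> ^^ (j + 1)) (\<beta> (k * m - 1 + i - j)))"

lemma D_carrier [simp]: "D k \<in> carrier_mat m m"
  by (simp add: D_def)

lemma D_R: "i < m \<Longrightarrow> j < m \<Longrightarrow> D k $$ (i, j) \<in> R"
  by (auto simp: D_def intro!: R_mult sigma_R sigma_pow_R beta_R)

text \<open>The matrix \<open>D k\<close> modulo \<open>p\<close>: the expansion of its determinant along row \<open>0\<close> has a single
  nonzero term, whose minor is lower triangular.\<close>

definition D_red :: "nat \<Rightarrow> 'k mat" where
  "D_red k = mat m m (\<lambda>(i, j). if i \<le> j \<and> j < m - 1 then 0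
     else (\<sigma> ^^ (j + 1)) (\<beta> (k * m - 1 + i - j)))"

lemma D_red_carrier [simp]: "D_red k \<in> carrier_mat m m"
  by (simp add: D_red_def)

lemma det_D_red:
  assumes "k \<ge> 1"
  shows "det (D_red k) = (-1) ^ (m - 1) *
    ((\<sigma> ^^ m) (\<beta> ((k - 1) * m)) * (\<Prod>j<m - 1. (\<sigma> ^^ Suc j) (\<beta> (k * m))))"
proof -
  let ?M = "mat_delete (D_red k) 0 (m - 1)"
  have km: "k * m \<ge> 1"
    using assms m_pos by simp
  have M: "?M \<in> carrier_mat (m - 1) (m - 1)"
    by (rule mat_delete_carrier[OF D_red_carrier])
  have M_nth: "?M $$ (i, j) = D_red k $$ (Suc i, j)" if "i < m - 1" "j < m - 1" for i j
    using that m_pos by (simp add: mat_delete_def D_red_def)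
  \<comment> \<open>Row \<open>i\<close> of the minor is row \<open>Suc i\<close> of
    \<open>D_red k\<close>, so the vanishing range \<open>Suc i \<le> j\<close> is the part above
    the diagonal.\<close>
  have "?M $$ (i, j) = 0" if "i < j" "j < m - 1" for i j
  proof -
    have "D_red k $$ (Suc i, j) = 0"
      using that by (simp add: D_red_def)
    then show ?thesis
      using M_nth[of i j] that by simp
  qed
  then have "det ?M = prod_list (diag_mat ?M)"
    using M by (rule det_lower_triangular)
  also have "\<dots> = (\<Prod>j<m - 1. (\<sigma> ^^ Suc j) (\<beta> (k * m)))"
  proof -
    \<comment> \<open>The row shift makes the index \<open>k * m - 1 + Suc j - j\<close>, which is
      \<open>k * m\<close> along the whole diagonal.\<close>
    have "?M $$ (j, j) = (\<sigma> ^^ Suc j) (\<beta> (k * m))" if "j < m - 1" for j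
    proof -
      have "D_red k $$ (Suc j, j) = (\<sigma> ^^ Suc j) (\<beta> (k * m))"
        using that km by (simp add: D_red_def)
      then show ?thesis
        using M_nth[of j j] that by simp
    qed
    then show ?thesis
      unfolding prod_list_diag_prod using M by (intro prod.cong) auto
  qed
  finally have det_M: "det ?M = \<dots>" .
  have "det (D_red k) = (\<Sum>j<m. D_red k $$ (0, j) * cofactor (D_red k) 0 j)"
    using m_pos by (intro laplace_expansion_row[OF D_red_carrier]) simp
  also have "\<dots> = D_red k $$ (0, m - 1) * cofactor (D_red k) 0 (m - 1)"
  proof -
    have "D_red k $$ (0, j) = 0" if "j \<in> {..<m} - {m - 1}" for j
      using that by (auto simp: D_red_def)
    then show ?thesis
      using m_pos by (subst sum.remove[of _ "m - 1"]) (auto intro!: sum.neutral)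
  qed
  \<comment> \<open>In the corner the index is \<open>k * m - 1 - (m - 1)\<close>, that is
    \<open>(k - 1) * m\<close>.\<close>
  also have "D_red k $$ (0, m - 1) = (\<sigma> ^^ m) (\<beta> ((k - 1) * m))"
    using m_pos by (simp add: D_red_def diff_mult_distrib)
  finally show ?thesis
    unfolding cofactor_def det_M by (simp add: mult_ac del: funpow.simps)
qed

text \<open>All values of \<open>\<beta>\<close> in the reduced determinant sit at multiples of
  \<open>m\<close>, so modulo p they are products of conjugates of \<open>\<beta> m\<close>;
  together the exponents run once through \<open>1\<close> to \<open>k * m - 1\<close>.\<close>

lemma det_D_cong:
  assumes "k \<ge> 1"
  shows "cong 1 (det (D k)) ((-1) ^ (m - 1) * (\<Prod>s=1..k * m - 1. (\<sigma> ^^ s) (\<beta> m)))"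
proof -
  have "cong 1 (det (D k)) (det (D_red k))"
  proof (rule det_cong[OF D_carrier D_red_carrier D_R])
    fix i j assume ij: "i < m" "j < m"
    then show "D_red k $$ (i, j) \<in> R"
      by (auto simp: D_red_def intro!: sigma_R sigma_pow_R beta_R)
    \<comment> \<open>Where the two matrices are defined differently, the entry of
      \<open>D k\<close> carries the factor \<open>P\<close>.\<close>
    show "cong 1 (D k $$ (i, j)) (D_red k $$ (i, j))"
    proof (cases "i \<le> j \<and> j < m - 1")
      case True
      then show ?thesis
        using ij cong_P_power[of "(\<sigma> ^^ (j + 1)) (\<beta> (k * m - 1 + i - j))" 1 1]
        by (simp add: D_def D_red_def sigma_pow_R[OF beta_R, of "Suc _", simplified])
    next
      case False
      then have "D k $$ (i, j) = D_red k $$ (i, j)"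
        using ij by (auto simp: D_def D_red_def)
      then show ?thesis by simp
    qed
  qed
  also have "cong 1 \<dots> ((-1) ^ (m - 1) * (\<Prod>s=1..k * m - 1. (\<sigma> ^^ s) (\<beta> m)))"
  proof -
    let ?B = "\<lambda>k. \<Prod>i<k. (\<sigma> ^^ (i * m)) (\<beta> m)"
    have B_R: "?B k \<in> R" for k
      by (intro R_prod sigma_pow_R beta_R)
    have shift: "(\<sigma> ^^ s) (?B k) = (\<Prod>i<k. (\<sigma> ^^ (i * m + s)) (\<beta> m))" for s k
      by (subst sigma_pow_prod) (auto simp: funpow_add[symmetric] add.commute sigma_pow_R beta_R
          simp flip: comp_apply[of "\<sigma> ^^ _" "\<sigma> ^^ _"])
    have "cong 1 ((\<sigma> ^^ m) (\<beta> ((k - 1) * m)) * (\<Prod>j<m - 1. (\<sigma> ^^ Suc j) (\<beta> (k * m))))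
       ((\<sigma> ^^ m) (?B (k - 1)) * (\<Prod>j<m - 1. (\<sigma> ^^ Suc j) (?B k)))"
      by (intro cong_mult cong_prod sigma_pow_cong beta_multiple_cong B_R sigma_pow_R beta_R R_prod)
    also have "(\<sigma> ^^ m) (?B (k - 1)) * (\<Prod>j<m - 1. (\<sigma> ^^ Suc j) (?B k))
        = (\<Prod>s=1..k * m - 1. (\<sigma> ^^ s) (\<beta> m))"
      unfolding shift by (rule prod_residue_classes[OF assms m_pos])
    finally show ?thesis
      unfolding det_D_red[OF assms] by (intro cong_mult_left R_power R_uminus R_1)
  qed
  finally show ?thesis .
qed

text \<open>\<open>\<beta> m\<close> is a unit by \<open>beta_unit\<close> at \<open>k = 1\<close>,
  and \<open>\<sigma>\<close> preserves units.\<close>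

lemma det_formula_unit: "(-1) ^ n * (\<Prod>s\<in>S. (\<sigma> ^^ s) (\<beta> m)) \<in> int_units \<nu>"
proof (rule unit_mult[OF _ unit_prod])
  show "(- 1) ^ n \<in> int_units \<nu>"
    by (cases "even n") (auto simp: unit_uminus)
  show "(\<sigma> ^^ s) (\<beta> m) \<in> int_units \<nu>" for s
    using sigma_pow_unit[OF beta_unit[of 1]] by simp
qed

lemma det_D_unit: "k \<ge> 1 \<Longrightarrow> det (D k) \<in> int_units \<nu>"
  by (rule unit_cong[OF det_formula_unit det_D_cong det_R[OF D_carrier D_R]])

section \<open>The linear system for the coefficients of the characteristic polynomial\<close>

text \<open>Row \<open>i\<close> is the recursion at \<open>n = k * m + i\<close> multiplied by
  \<open>P ^ k\<close>, which turns its integral error into an error modulo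
  \<open>P ^ k\<close>.\<close>

lemma D_solution_cong:
  assumes k: "k \<ge> 1"
    and rec: "\<And>n. m \<le> n \<Longrightarrow> c n - (\<Sum>s=1..m. \<alpha> s * (\<phi> ^^ s) (c (n - s))) / P \<in> R"
    and i: "i < m"
  shows "cong k (\<beta> (k * m + i))
    ((D k *\<^sub>v vec m (\<lambda>j. if j < m - 1 then \<alpha> (j + 1) / P else \<alpha> m)) $ i)"
proof -
  define n where "n = k * m + i"
  have n: "n div m = k" "m \<le> n"
    using i k by (auto simp: n_def trans_le_add1)
  have "P ^ k * (\<alpha> (Suc j) * (\<phi> ^^ Suc j) (c (n - Suc j)) / P)
      = D k $$ (i, j) * (if j < m - 1 then \<alpha> (j + 1) / P else \<alpha> m)" if j: "j < m" for j
  proof -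
    have idx: "k * m - 1 + i - j = n - Suc j"
      using k m_pos by (simp add: n_def)
    have D_nth: "D k $$ (i, j) = P ^ (if j < i \<or> j = m - 1 then 0 else 1)
        * (\<sigma> ^^ Suc j) (\<beta> (n - Suc j))"
      using i j unfolding D_def idx[symmetric] by (simp del: funpow.simps)
    \<comment> \<open>Only the last unknown is \<open>\<alpha> m\<close> itself instead of a
      quotient by \<open>P\<close>; the power of \<open>P\<close> records this.\<close>
    have a: "(if j < m - 1 then \<alpha> (j + 1) / P else \<alpha> m)
        = P ^ (if j = m - 1 then 1 else 0) * (\<alpha> (Suc j) / P)"
      using j by (cases "j = m - 1") auto
    have "P ^ k * (\<alpha> (Suc j) * (\<phi> ^^ Suc j) (c (n - Suc j)) / P)
        = \<alpha> (Suc j) / P * (P ^ k * (\<phi> ^^ Suc j) (c (n - Suc j)))"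
      by (simp del: funpow.simps)
    also have "P ^ k * (\<phi> ^^ Suc j) (c (n - Suc j))
        = P ^ (k - (n - Suc j) div m) * (\<sigma> ^^ Suc j) (\<beta> (n - Suc j))"
      using scaled_twist[of n "Suc j"] beta_R n by simp
    \<comment> \<open>The quotient of \<open>n - Suc j\<close> stays \<open>k\<close> while
      \<open>j < i\<close> and is \<open>k - 1\<close> from \<open>j = i\<close> on. In the last
      column the resulting \<open>P\<close> cancels the denominator of
      \<open>\<alpha> m / P\<close>.\<close>
    also have "k - (n - Suc j) div m = (if j < i then 0 else 1)"
    proof (cases "j < i")
      case True
      then have "n - Suc j = k * m + (i - Suc j)"
        by (simp add: n_def)
      moreover have "i - Suc j < m"
        using i by simp
      ultimately have "(n - Suc j) div m = k"
        by simp
      then show ?thesis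
        using True by simp
    next
      case False
      then have "n - Suc j = (k - 1) * m + (m + i - Suc j)"
        using j k by (cases k) (auto simp: n_def)
      moreover have "m + i - Suc j < m"
        using False m_pos by simp
      ultimately show ?thesis
        using False k by simp
    qed
    finally show ?thesis
      unfolding D_nth a using i j
      by (cases "j < i"; cases "j = m - 1") (simp_all add: mult_ac del: funpow.simps)
  qed
  then have "(\<Sum>j<m. P ^ k * (\<alpha> (Suc j) * (\<phi> ^^ Suc j) (c (n - Suc j)) / P))
      = (D k *\<^sub>v vec m (\<lambda>j. if j < m - 1 then \<alpha> (j + 1) / P else \<alpha> m)) $ i"
    using i by (auto simp: scalar_prod_def lessThan_atLeast0 D_def intro!: sum.cong)
  moreover have "(\<Sum>j<m. P ^ k * (\<alpha> (Suc j) * (\<phi> ^^ Suc j) (c (n - Suc j)) / P))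
      = P ^ k * ((\<Sum>s=1..m. \<alpha> s * (\<phi> ^^ s) (c (n - s))) / P)"
    unfolding sum_divide_distrib sum_distrib_left
    by (rule sum.reindex_bij_witness[of _ "\<lambda>s. s - 1" Suc]) auto
  ultimately show ?thesis
    unfolding cong_ppow_def n_def[symmetric] \<beta>_def n(1)
    using rec[OF n(2)] by (metis right_diff_distrib)
qed

text \<open>Multiplying by an integral matrix preserves congruences modulo \<open>P ^ k\<close>, and
  \<open>E * D k\<close> is exactly the identity, so the system can be solved for the
  unknowns.\<close>

lemma inverse_D_solution_cong:
  assumes k: "k \<ge> 1"
    and rec: "\<And>n. m \<le> n \<Longrightarrow> c n - (\<Sum>s=1..m. \<alpha> s * (\<phi> ^^ s) (c (n - s))) / P \<in> R"
    and E: "E \<in> carrier_mat m m" "inverts_mat E (D k)"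
      "\<And>i j. i < m \<Longrightarrow> j < m \<Longrightarrow> E $$ (i, j) \<in> R"
    and i: "i < m"
  shows "cong k (if i < m - 1 then \<alpha> (i + 1) / P else \<alpha> m)
    ((E *\<^sub>v vec m (\<lambda>l. \<beta> (k * m + l))) $ i)"
proof -
  define a where "a = vec m (\<lambda>j. if j < m - 1 then \<alpha> (j + 1) / P else \<alpha> m)"
  have a: "a \<in> carrier_vec m"
    by (simp add: a_def)
  have "cong k (\<Sum>j<m. E $$ (i, j) * \<beta> (k * m + j)) (\<Sum>j<m. E $$ (i, j) * (D k *\<^sub>v a) $ j)"
    using D_solution_cong[OF k rec] E(3) i unfolding a_def
    by (intro cong_sum cong_mult_left) auto
  also have "(\<Sum>j<m. E $$ (i, j) * (D k *\<^sub>v a) $ j) = (E *\<^sub>v (D k *\<^sub>v a)) $ i"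
    using i E(1) by (auto simp: scalar_prod_def lessThan_atLeast0 D_def intro!: sum.cong)
  also have "E *\<^sub>v (D k *\<^sub>v a) = (E * D k) *\<^sub>v a"
    by (rule assoc_mult_mat_vec[OF E(1) D_carrier a, symmetric])
  also have "\<dots> = a"
    using E(1,2) a by (simp add: inverts_mat_def)
  also have "(\<Sum>j<m. E $$ (i, j) * \<beta> (k * m + j)) = (E *\<^sub>v vec m (\<lambda>l. \<beta> (k * m + l))) $ i"
    using i E(1) by (auto simp: scalar_prod_def lessThan_atLeast0 intro!: sum.cong)
  finally show ?thesis
    using i by (simp add: a_def cong_sym)
qed

end

section \<open>Passage from the logarithm to the recursions and back\<close>

theorem theorem2:
  fixes p :: nat
    and \<nu> :: "'k::field_char_0 \<Rightarrow> int extended"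
    and \<sigma> :: "'k \<Rightarrow> 'k"
    and F :: "'k fps fps"
    and h :: enat
    and b :: "nat \<Rightarrow> 'k"
  assumes "unramified_cdvf p \<nu>"
    and "frobenius_lift p \<nu> \<sigma>"
    and "formal_group_law \<nu> F"
    and "fgl_has_height p \<nu> \<sigma> F h"
    and "\<And>n. b n \<in> int_ring \<nu>"
    and "b 0 = 1"
    and "fgl_log F = Abs_fps (\<lambda>n. if n = 0 then 0 else b (n - 1) / of_nat n)"
  shows
    "(h = \<infinity> \<longrightarrow> (\<forall>n. Fin (int n) \<le> \<nu> (b (p ^ n - 1)))) \<and>
     (\<forall>m. h = enat m \<longrightarrow>
        (\<forall>n. Fin (int n - int (n div m)) \<le> \<nu> (b (p ^ n - 1)) \<and>
             (m dvd n \<longrightarrow> \<nu> (b (p ^ n - 1)) = Fin (int n - int (n div m)))) \<and>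
        (\<forall>n. fgl_beta p b m n \<in> int_ring \<nu>) \<and>
        (\<forall>k\<ge>1. cong_ppow p \<nu> 1 (fgl_beta p b m (k * m))
                  (\<Prod>i=0..k - 1. (\<sigma> ^^ (i * m)) (fgl_beta p b m m))) \<and>
        (\<forall>k\<ge>1.
           (\<forall>i<m. \<forall>j<m. fgl_D p \<sigma> b m k $$ (i, j) \<in> int_ring \<nu>) \<and>
           cong_ppow p \<nu> 1 (det (fgl_D p \<sigma> b m k))
             ((-1) ^ (m - 1) * (\<Prod>s=1..k * m - 1. (\<sigma> ^^ s) (fgl_beta p b m m))) \<and>
           \<not> cong_ppow p \<nu> 1
               ((-1) ^ (m - 1) * (\<Prod>s=1..k * m - 1. (\<sigma> ^^ s) (fgl_beta p b m m))) 0 \<and>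
           (\<exists>E\<in>carrier_mat m m.
              inverts_mat (fgl_D p \<sigma> b m k) E \<and> inverts_mat E (fgl_D p \<sigma> b m k) \<and>
              (\<forall>i<m. \<forall>j<m. E $$ (i, j) \<in> int_ring \<nu>) \<and>
              (\<forall>\<alpha>. fgl_has_char_poly p \<nu> \<sigma> F m ([:of_nat p:] - (\<Sum>i=1..m. monom (\<alpha> i) i)) \<longrightarrow>
                 (\<forall>i<m. cong_ppow p \<nu> k
                    (if i < m - 1 then \<alpha> (i + 1) / of_nat p else \<alpha> m)
                    ((E *\<^sub>v vec m (\<lambda>l. fgl_beta p b m (k * m + l))) $ i))))))"
proof -
  interpret unramified_frobenius p \<nu> \<sigma>
    using assms(1,2) by unfold_locales
  define c where "c n = b (p ^ n - 1) / P ^ n" for n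
  have log_nth: "fps_nth (fgl_log F) (p ^ n) = c n" for n
    unfolding assms(7) c_def by simp
  have val_b: "\<nu> (b (p ^ n - 1)) = \<nu> (P ^ n * c n)" for n
    by (simp add: c_def)
  obtain v where type: "fgl_type p \<nu> \<sigma> F v"
    and h: "h = Inf (enat ` {s. 1 \<le> s \<and> v s \<in> int_units \<nu>})"
    using assms(4) unfolding fgl_has_height_def by blast
  have v_R: "v s \<in> R" if "1 \<le> s" for s
    using type that unfolding fgl_type_def by blast
  have rec: "c n - (\<Sum>s=1..n. v s * (\<phi> ^^ s) (c (n - s))) / P \<in> R" for n
    using type_recursion[OF type, of n] unfolding log_nth .
  \<comment> \<open>A unit \<open>v s\<close> would force the infimum \<open>h\<close> to be at most
    \<open>s\<close>.\<close>
  have below_height: "cong 1 (v s) 0" if "1 \<le> s" "enat s < h" for s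
  proof (rule non_unit_cong_0[OF v_R[OF that(1)]])
    show "v s \<notin> int_units \<nu>"
      using that unfolding h by (metis (mono_tags, lifting) Inf_lower imageI leD mem_Collect_eq)
  qed
  show ?thesis (is "?infinite \<and> (\<forall>m. h = enat m \<longrightarrow> ?finite m)")
  proof (intro conjI allI)
    \<comment> \<open>If \<open>h = \<infinity>\<close>, every \<open>v s\<close> is divisible by p,
      so \<open>c n\<close> is integral and \<open>P ^ n\<close> divides
      \<open>b (p ^ n - 1)\<close>.\<close>
    show ?infinite
      unfolding val_b val_ge_iff
      using infinite_height_integral[OF rec below_height] by auto
    fix m
    show "h = enat m \<longrightarrow> ?finite m"
    proof
      assume hm: "h = enat m"
      \<comment> \<open>A finite infimum is not that of the empty set, and in the well-ordered
        \<open>enat\<close> it is attained; hence \<open>v m\<close> itself is a unit.\<close>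
      then have "{s. 1 \<le> s \<and> v s \<in> int_units \<nu>} \<noteq> {}"
        unfolding h by (metis Inf_empty image_is_empty top_enat_def enat.distinct(1))
      then obtain s where "s \<in> {s. 1 \<le> s \<and> v s \<in> int_units \<nu>}"
        by blast
      then have "h \<in> enat ` {s. 1 \<le> s \<and> v s \<in> int_units \<nu>}"
        unfolding h by (rule wellorder_InfI[OF imageI])
      then have m: "1 \<le> m" "v m \<in> int_units \<nu>"
        using hm by auto
      interpret finite_height_recursion p \<nu> \<sigma> v c m
        using m v_R rec below_height hm assms(6) by unfold_locales (auto simp: c_def)
      have beta: "fgl_beta p b m = \<beta>"
      proof
        fix n
        have "P ^ n = P ^ (n - n div m) * P ^ (n div m)"
          by (simp add: power_add[symmetric])
        then show "fgl_beta p b m n = \<beta> n"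
          by (simp add: fgl_beta_def \<beta>_def c_def)
      qed
      have D: "fgl_D p \<sigma> b m k = D k" for k
        unfolding fgl_D_def D_def beta ..
      \<comment> \<open>The valuation of \<open>\<beta> n\<close> measures the excess over the
        claimed bound; it is zero when \<open>m\<close> divides \<open>n\<close>.\<close>
      have val_b_beta: "\<nu> (b (p ^ n - 1)) = Fin (int n - int (n div m)) + \<nu> (\<beta> n)" for n
      proof -
        have "P ^ n * c n = P ^ (n - n div m) * \<beta> n"
          by (simp add: \<beta>_def power_add[symmetric])
        then have "\<nu> (b (p ^ n - 1)) = \<nu> (P ^ (n - n div m)) + \<nu> (\<beta> n)"
          by (simp only: val_b flip: val_mult)
        then show ?thesis
          by (simp add: val_P_power of_nat_diff)
      qed
      have valuation: "Fin (int n - int (n div m)) \<le> \<nu> (b (p ^ n - 1))"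
        "m dvd n \<Longrightarrow> \<nu> (b (p ^ n - 1)) = Fin (int n - int (n div m))" for n
      proof -
        show "Fin (int n - int (n div m)) \<le> \<nu> (b (p ^ n - 1))"
          using beta_R[of n] unfolding val_b_beta R_iff by (cases "\<nu> (\<beta> n)") auto
        assume "m dvd n"
        then have "\<nu> (\<beta> n) = Fin 0"
          using beta_unit[of "n div m"] by (simp add: val_unit_iff)
        then show "\<nu> (b (p ^ n - 1)) = Fin (int n - int (n div m))"
          unfolding val_b_beta by simp
      qed
      have prod_cong: "cong 1 (\<beta> (k * m)) (\<Prod>i=0..k - 1. (\<sigma> ^^ (i * m)) (\<beta> m))" if "1 \<le> k" for k
      proof -
        \<comment> \<open>For \<open>k = 0\<close> truncated subtraction would leave
          \<open>{0}\<close>; \<open>1 \<le> k\<close> excludes this.\<close>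
        have "{0..k - 1} = {..<k}"
          using that by auto
        then show ?thesis
          using beta_multiple_cong by simp
      qed
      have inverse: "\<exists>E\<in>carrier_mat m m. inverts_mat (D k) E \<and> inverts_mat E (D k) \<and>
          (\<forall>i<m. \<forall>j<m. E $$ (i, j) \<in> R) \<and>
          (\<forall>\<alpha>. fgl_has_char_poly p \<nu> \<sigma> F m ([:P:] - (\<Sum>i=1..m. monom (\<alpha> i) i)) \<longrightarrow>
            (\<forall>i<m. cong k (if i < m - 1 then \<alpha> (i + 1) / P else \<alpha> m)
              ((E *\<^sub>v vec m (\<lambda>l. \<beta> (k * m + l))) $ i)))" if k: "1 \<le> k" for k
      proof -
        obtain E where E: "E \<in> carrier_mat m m" "inverts_mat (D k) E" "inverts_mat E (D k)"
          "\<And>i j. i < m \<Longrightarrow> j < m \<Longrightarrow> E $$ (i, j) \<in> R"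
          using integral_inverse_mat[OF D_carrier D_R det_D_unit[OF k]] by blast
        \<comment> \<open>\<open>E\<close> depends on \<open>D k\<close> alone, so it is chosen
          before \<open>\<alpha>\<close>.\<close>
        have "cong k (if i < m - 1 then \<alpha> (i + 1) / P else \<alpha> m)
            ((E *\<^sub>v vec m (\<lambda>l. \<beta> (k * m + l))) $ i)"
          if "fgl_has_char_poly p \<nu> \<sigma> F m ([:P:] - (\<Sum>i=1..m. monom (\<alpha> i) i))" "i < m" for \<alpha> i
          by (rule inverse_D_solution_cong[OF k _ E(1,3,4) that(2)])
            (rule char_poly_recursion[OF that(1), unfolded log_nth])
        with E show ?thesis by blast
      qed
      show "?finite m"
        unfolding beta D
        by (intro conjI allI impI valuation beta_R prod_cong D_R det_D_cong
            unit_not_cong_0[OF det_formula_unit] inverse)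
    qed
  qed
qed

end
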